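(* Let $G$ be a finite abstract simplicial complex with $n$ elements and let $L$ be its $n\times n$ connection matrix. Let $\lambda_1\ge\lambda_2\ge\cdots\ge\lambda_n$ be the eigenvalues of $L$ (with multiplicity) in descending order, and let $d_1\ge d_2\ge\cdots\ge d_n$ be the connection degrees $d(x)$, $x\in G$, in descending order. Then $\lambda_j\le d_j$ for all $1\le j\le n$.
   Context: A finite abstract simplicial complex $G$ is a finite set of non-empty finite sets (simplices) closed under taking non-empty subsets. The dimension of $x \in G$ is $\dim(x)=|x|-1$, and $\omega(x)=(-1)^{\dim(x)}$. For $A\subset G$, $\chi(A)=\sum_{x\in A}\omega(x)$ (so $\chi(\emptyset)=0$). For $x\in G$, $C(x)=\{y\in G: y\subset x\}$. The connection matrix $L$ is the symmetric matrix indexed by $G\times G$ with $L(x,y)=\chi(C(x)\cap C(y))$, i.e. $L(x,y)=1$ if $x\cap y\ne\emptyset$ and $L(x,y)=0$ otherwise. The connection degree of $x\in G$ is $d(x)=|\{y\in G:\chi(C(x)\cap C(y))\ne 0\}|$, i.e. the number of $y\in G$ (including $y=x$) with $x\cap y\neq\emptyset$. *)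

theory Defs
  imports "Jordan_Normal_Form.Char_Poly"
begin

definition simplicial_complex :: "'a set set \<Rightarrow> bool" where
  "simplicial_complex G \<longleftrightarrow>
     finite G \<and>
     (\<forall>x\<in>G. finite x \<and> x \<noteq> {}) \<and>
     (\<forall>x\<in>G. \<forall>y. y \<subseteq> x \<and> y \<noteq> {} \<longrightarrow> y \<in> G)"

text \<open>The truncated subtraction is harmless: every simplex of a complex is finite and non-empty.\<close>

definition simplex_dim :: "'a set \<Rightarrow> nat" where
  "simplex_dim x = card x - 1"

definition simplex_sign :: "'a set \<Rightarrow> int" where
  "simplex_sign x = (-1) ^ simplex_dim x"

definition euler_char :: "'a set set \<Rightarrow> int" where
  "euler_char A = (\<Sum>x\<in>A. simplex_sign x)"

definition core :: "'a set set \<Rightarrow> 'a set \<Rightarrow> 'a set set" where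
  "core G x = {y \<in> G. y \<subseteq> x}"

text \<open>
  Matrices are indexed by natural numbers, so the connection matrix is taken with respect to
  an enumeration \<open>xs\<close> of the simplices of \<open>G\<close>.
\<close>

definition connection_matrix :: "'a set set \<Rightarrow> 'a set list \<Rightarrow> real mat" where
  "connection_matrix G xs =
     mat (length xs) (length xs)
       (\<lambda>(i, j). real_of_int (euler_char (core G (xs ! i) \<inter> core G (xs ! j))))"

definition connection_degree :: "'a set set \<Rightarrow> 'a set \<Rightarrow> nat" where
  "connection_degree G x = card {y \<in> G. euler_char (core G x \<inter> core G y) \<noteq> 0}"

definition degrees_desc :: "'a set set \<Rightarrow> nat list" where
  "degrees_desc G =
     rev (sorted_list_of_multiset (image_mset (connection_degree G) (mset_set G)))"

text \<open>
  The real eigenvalues with their algebraic multiplicities. For a symmetric matrix these are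
  all the eigenvalues, see \<open>length_eigenvalues_desc\<close> below.
\<close>

definition eigenvalues_desc :: "real mat \<Rightarrow> real list" where
  "eigenvalues_desc A = rev (sorted_list_of_multiset (proots (char_poly A)))"

lemma symmetric_eigenvalue_real:
  fixes A :: "real mat"
  assumes A: "A \<in> carrier_mat n n" and sym: "transpose_mat A = A"
    and ev: "eigenvalue (map_mat complex_of_real A) a"
  shows "a \<in> \<real>"
proof -
  let ?B = "map_mat complex_of_real A"
  from ev obtain v where v: "v \<in> carrier_vec n" "v \<noteq> 0\<^sub>v n" "?B *\<^sub>v v = a \<cdot>\<^sub>v v"
    using A unfolding eigenvalue_def eigenvector_def by auto
  have symA: "A $$ (i, j) = A $$ (j, i)" if "i < n" "j < n" for i j
    using that A arg_cong[OF sym, of "\<lambda>M. M $$ (i, j)"] by auto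
  have row: "(\<Sum>j<n. complex_of_real (A $$ (i, j)) * v $ j) = a * v $ i" if "i < n" for i
    using that A v(1) arg_cong[OF v(3), of "\<lambda>w. w $ i"]
    by (auto simp: scalar_prod_def lessThan_atLeast0)
  define S where "S = (\<Sum>i<n. \<Sum>j<n. complex_of_real (A $$ (i, j)) * v $ j * cnj (v $ i))"
  define N where "N = (\<Sum>i<n. (cmod (v $ i))\<^sup>2)"
  have "S = (\<Sum>i<n. a * v $ i * cnj (v $ i))"
    unfolding S_def by (intro sum.cong refl) (simp add: row sum_distrib_right[symmetric])
  also have "\<dots> = a * complex_of_real N"
    unfolding N_def of_real_sum sum_distrib_left
    by (intro sum.cong refl) (metis complex_norm_square mult.assoc)
  finally have S: "S = a * complex_of_real N" .
  have "cnj S = (\<Sum>i<n. \<Sum>j<n. complex_of_real (A $$ (i, j)) * cnj (v $ j) * v $ i)"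
    unfolding S_def by simp
  also have "\<dots> = (\<Sum>j<n. \<Sum>i<n. complex_of_real (A $$ (i, j)) * cnj (v $ j) * v $ i)"
    by (rule sum.swap)
  also have "\<dots> = S"
    unfolding S_def by (intro sum.cong refl) (simp add: symA mult_ac)
  finally have "S \<in> \<real>" by (simp add: Reals_cnj_iff)
  moreover have "N \<noteq> 0"
  proof
    assume "N = 0"
    hence "\<forall>i<n. v $ i = 0" unfolding N_def by (subst (asm) sum_nonneg_eq_0_iff) auto
    with v(1) have "v = 0\<^sub>v n" by (intro eq_vecI) auto
    with v(2) show False by simp
  qed
  ultimately have "S / complex_of_real N \<in> \<real>" "S / complex_of_real N = a"
    using S by (blast intro: Reals_divide Reals_of_real, simp add: S \<open>N \<noteq> 0\<close>)
  thus ?thesis by simp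
qed

lemma length_eigenvalues_desc:
  fixes A :: "real mat"
  assumes A: "A \<in> carrier_mat n n" and sym: "transpose_mat A = A"
  shows "length (eigenvalues_desc A) = n"
proof -
  interpret of_real_poly_hom: map_poly_inj_idom_hom complex_of_real ..
  let ?B = "map_mat complex_of_real A"
  have B: "?B \<in> carrier_mat n n" using A by simp
  obtain as where as: "char_poly ?B = (\<Prod>a\<leftarrow>as. [:- a, 1:])" "length as = n"
    using char_poly_factorized[OF B] by blast
  have "a \<in> \<real>" if "a \<in> set as" for a
  proof -
    have "poly (char_poly ?B) a = 0"
      unfolding as(1) using that by (induction as) auto
    thus ?thesis
      using symmetric_eigenvalue_real[OF A sym] eigenvalue_root_char_poly[OF B] by blast
  qed
  hence *: "as = map complex_of_real (map Re as)" by (induction as) auto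
  have hom: "map_poly complex_of_real (\<Prod>r\<leftarrow>rs. [:- r, 1:]) =
      (\<Prod>a\<leftarrow>map complex_of_real rs. [:- a, 1:])" for rs
    by (induction rs) (simp_all del: mult_pCons_left add: of_real_hom.map_poly_pCons_hom
          of_real_poly_hom.hom_mult)
  have "map_poly complex_of_real (char_poly A) =
      map_poly complex_of_real (\<Prod>r\<leftarrow>map Re as. [:- r, 1:])"
    unfolding hom *[symmetric] as(1)[symmetric] by (rule of_real_hom.char_poly_hom[OF A, symmetric])
  hence "char_poly A = (\<Prod>r\<leftarrow>map Re as. [:- r, 1:])"
    by (simp add: of_real_poly_hom.eq_iff)
  moreover have "proots (\<Prod>r\<leftarrow>rs. [:- r, 1:]) = mset rs" for rs :: "real list"
  proof (induction rs)
    case (Cons r rs)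
    have "(\<Prod>r\<leftarrow>rs. [:- r, 1:]) \<noteq> 0" by (auto simp: prod_list_zero_iff)
    with Cons show ?case by (simp del: mult_pCons_left add: proots_mult)
  qed simp
  ultimately have "proots (char_poly A) = mset (map Re as)" by (simp only:)
  hence "size (proots (char_poly A)) = n" using as(2) by simp
  thus ?thesis
    unfolding eigenvalues_desc_def by (metis length_rev mset_sorted_list_of_multiset size_mset)
qed

lemma length_eigenvalues_desc_connection_matrix:
  "length (eigenvalues_desc (connection_matrix G xs)) = length xs"
  by (rule length_eigenvalues_desc) (auto simp: connection_matrix_def Int_commute)

end

(* All entries of L are 0 or 1, and the row of x sums to d(x). By x_i x_j <= (x_i^2 + x_j^2) / 2 the
   quadratic form of L is therefore dominated by that of the diagonal matrix of the degrees, and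
   the bound on the ordered eigenvalues follows from the Courant-Fischer principle. *)

theory Submission
  imports Defs "Jordan_Normal_Form.Schur_Decomposition"
begin

section \<open>Orthogonal diagonalisation of real symmetric matrices\<close>

text \<open>Complete \<open>v\<close> to a basis, apply Gram-Schmidt and normalise. Gram-Schmidt
  leaves the first vector alone, so column 0 stays a multiple of \<open>v\<close>.\<close>

lemma orthonormal_completion:
  fixes v :: "real vec"
  assumes v: "v \<in> carrier_vec n" "v \<noteq> 0\<^sub>v n" and n: "0 < n"
  obtains W c where "W \<in> carrier_mat n n" "transpose_mat W * W = 1\<^sub>m n" "col W 0 = c \<cdot>\<^sub>v v"
proof -
  interpret cof_vec_space n "TYPE(real)" .
  define b where "b = basis_completion v"
  define ws where "ws = gram_schmidt n b"
  note bc = basis_completion[OF v, folded b_def]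
  note gs = gram_schmidt_result[OF bc(2,4,5) ws_def]
  have len: "length ws = n" using gs(4) bc(6) by simp
  obtain vs where b: "b = v # vs" using bc(6,7) n by (cases b) auto
  have hd: "hd ws = v" unfolding ws_def b by (rule gram_schmidt_hd[OF v(1)])
  have carr: "ws ! i \<in> carrier_vec n" if "i < n" for i using gs(3) len that by auto
  \<comment> \<open>Over the reals conjugation is trivial, so this is ordinary orthogonality. The
    case \<open>i = j\<close> also says that no vector is null, so each can be normalised.\<close>
  have orth: "ws ! i \<bullet> ws ! j = 0 \<longleftrightarrow> i \<noteq> j" if "i < n" "j < n" for i j
    using corthogonalD[OF gs(2), of i j] len that by simp
  define s where "s i = sqrt (ws ! i \<bullet> ws ! i)" for i
  have s: "s i * s i = ws ! i \<bullet> ws ! i" "s i \<noteq> 0" if "i < n" for i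
  proof -
    have "0 \<le> ws ! i \<bullet> ws ! i" by (auto simp: scalar_prod_def intro!: sum_nonneg)
    thus "s i * s i = ws ! i \<bullet> ws ! i" "s i \<noteq> 0"
      using orth[OF that that] unfolding s_def by auto
  qed
  define W where "W = mat_of_cols n (map (\<lambda>i. (1 / s i) \<cdot>\<^sub>v ws ! i) [0..<n])"
  have W: "W \<in> carrier_mat n n" unfolding W_def by (simp add: mat_of_cols_def)
  have col: "col W i = (1 / s i) \<cdot>\<^sub>v ws ! i" if "i < n" for i
    unfolding W_def using that carr by (subst col_mat_of_cols) auto
  have "transpose_mat W * W = 1\<^sub>m n"
  proof (rule eq_matI)
    fix i j assume "i < dim_row (1\<^sub>m n)" "j < dim_col (1\<^sub>m n)"
    hence ij: "i < n" "j < n" by auto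
    have "(transpose_mat W * W) $$ (i, j) = (1 / s i) * ((1 / s j) * (ws ! i \<bullet> ws ! j))"
      using W ij carr[of i] carr[of j] by (simp add: col)
    thus "(transpose_mat W * W) $$ (i, j) = 1\<^sub>m n $$ (i, j)"
      using orth[OF ij] s[OF ij(1)] ij by (cases "i = j") (auto simp flip: s(1))
  qed (use W in auto)
  moreover have "col W 0 = (1 / s 0) \<cdot>\<^sub>v v"
    using col[OF n] hd len n by (metis hd_conv_nth length_greater_0_conv)
  ultimately show thesis using W that by blast
qed

text \<open>Extends a congruence of the lower block to the whole matrix. With identity blocks it
  shows that \<open>P\<close> inherits orthogonality from \<open>F\<close>; with the deflated matrix
  it carries the inductive diagonalisation one dimension up.\<close>

lemma transpose_congruence_block:
  fixes F :: "'a :: comm_ring_1 mat"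
  assumes F: "F \<in> carrier_mat m m" and B: "B \<in> carrier_mat m m" and C: "C \<in> carrier_mat 1 1"
  defines "P \<equiv> four_block_mat (1\<^sub>m 1) (0\<^sub>m 1 m) (0\<^sub>m m 1) F"
  shows "transpose_mat P * four_block_mat C (0\<^sub>m 1 m) (0\<^sub>m m 1) B * P =
    four_block_mat C (0\<^sub>m 1 m) (0\<^sub>m m 1) (transpose_mat F * B * F)"
proof -
  note z = one_carrier_mat[of 1] zero_carrier_mat[of 1 m] zero_carrier_mat[of m 1]
  have F': "transpose_mat F \<in> carrier_mat m m" and FB: "transpose_mat F * B \<in> carrier_mat m m"
    using F B by auto
  have "transpose_mat P = four_block_mat (1\<^sub>m 1) (0\<^sub>m 1 m) (0\<^sub>m m 1) (transpose_mat F)"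
    unfolding P_def transpose_four_block_mat[OF z F] by simp
  moreover have "\<dots> * four_block_mat C (0\<^sub>m 1 m) (0\<^sub>m m 1) B =
      four_block_mat C (0\<^sub>m 1 m) (0\<^sub>m m 1) (transpose_mat F * B)"
    unfolding mult_four_block_mat[OF z F' C z(2,3) B] using C F' B by simp
  moreover have "\<dots> * P = four_block_mat C (0\<^sub>m 1 m) (0\<^sub>m m 1) (transpose_mat F * B * F)"
    unfolding P_def mult_four_block_mat[OF C z(2,3) FB z F] using C F FB right_mult_zero_mat[OF FB] by simp
  ultimately show ?thesis by simp
qed

text \<open>Deflation: an orthogonal change of basis starting with an eigenvector for the first root
  splits off a block of size 1, and induction handles the rest. Any ordering of the roots may be
  prescribed on the diagonal, so a descending one can be chosen later.\<close>

lemma symmetric_diagonalisation: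
  fixes A :: "real mat"
  assumes "A \<in> carrier_mat n n" and "transpose_mat A = A"
    and "char_poly A = (\<Prod>e\<leftarrow>es. [:- e, 1:])"
  shows "\<exists>W \<in> carrier_mat n n. transpose_mat W * W = 1\<^sub>m n \<and>
    transpose_mat W * A * W = mat_diag n ((!) es)"
  using assms
proof (induction es arbitrary: n A)
  case Nil
  hence "n = 0" using degree_monic_char_poly[OF Nil(1)] by simp
  thus ?case using Nil by (intro bexI[of _ "1\<^sub>m n"]) (auto intro: eq_matI simp: mat_diag_def)
next
  case (Cons e es)
  note A = Cons.prems(1) and sym = Cons.prems(2)
  have root: "poly (char_poly A) e = 0" by (simp add: Cons.prems(3) del: mult_pCons_left)
  \<comment> \<open>A matrix of size 0 has characteristic polynomial 1, which has no root.\<close>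
  have "n \<noteq> 0"
  proof
    assume "n = 0"
    hence "char_poly A = 1" using degree_monic_char_poly[OF A] monic_degree_0[of "char_poly A"] by simp
    with root show False by simp
  qed
  then obtain m where n: "n = Suc m" by (cases n) auto
  obtain v where v: "v \<in> carrier_vec n" "v \<noteq> 0\<^sub>v n" "A *\<^sub>v v = e \<cdot>\<^sub>v v"
    using root eigenvalue_root_char_poly[OF A] A unfolding eigenvalue_def eigenvector_def by auto
  obtain U c where U: "U \<in> carrier_mat n n" and UU: "transpose_mat U * U = 1\<^sub>m n"
    and U0: "col U 0 = c \<cdot>\<^sub>v v"
    using orthonormal_completion[OF v(1,2)] n by blast
  have UU': "U * transpose_mat U = 1\<^sub>m n"
    using UU U by (intro mat_mult_left_right_inverse[of "transpose_mat U"]) auto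
  define A' where "A' = transpose_mat U * A * U"
  have A': "A' \<in> carrier_mat n n" unfolding A'_def using U A by auto
  have symA': "transpose_mat A' = A'"
  proof -
    have "transpose_mat A' = transpose_mat U * (transpose_mat A * U)"
      unfolding A'_def using U A
      by (simp add: transpose_mult[of _ n n _ n])
    thus ?thesis unfolding A'_def sym using U A by simp
  qed
  \<comment> \<open>Column 0 of \<open>U\<close> is still an eigenvector for \<open>e\<close>, so
    column 0 of \<open>A'\<close> is \<open>e\<close> times column 0 of the identity; by symmetry
    the same holds for row 0.\<close>
  have colA': "A' $$ (i, 0) = (if i = 0 then e else 0)" if i: "i < n" for i
  proof -
    have "A' $$ (i, 0) = col U i \<bullet> (A *\<^sub>v col U 0)"
      unfolding A'_def using U A i n
      by (subst assoc_mult_mat[of _ n n _ n _ n]) (auto simp: mult_mat_vec_def)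
    also have "A *\<^sub>v col U 0 = e \<cdot>\<^sub>v col U 0"
      unfolding U0 using A v by (simp add: mult_mat_vec smult_smult_assoc mult.commute)
    also have "col U i \<bullet> (e \<cdot>\<^sub>v col U 0) = e * (transpose_mat U * U) $$ (i, 0)"
      using U i n by auto
    finally show ?thesis unfolding UU using i n by simp
  qed
  have rowA': "A' $$ (0, i) = (if i = 0 then e else 0)" if "i < n" for i
    using colA'[OF that] arg_cong[OF symA', of "\<lambda>M. M $$ (0, i)"] A' that n by simp
  define E :: "real mat" where "E = mat 1 1 (\<lambda>_. e)"
  define B where "B = mat m m (\<lambda>(i, j). A' $$ (Suc i, Suc j))"
  have E: "E \<in> carrier_mat 1 1" and B: "B \<in> carrier_mat m m" unfolding E_def B_def by auto
  have block: "A' = four_block_mat E (0\<^sub>m 1 m) (0\<^sub>m m 1) B"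
    using A' colA' rowA' n by (intro eq_matI) (auto simp: E_def B_def)
  have "transpose_mat B = B"
  proof (rule eq_matI)
    fix i j assume "i < dim_row B" "j < dim_col B"
    thus "transpose_mat B $$ (i, j) = B $$ (i, j)"
      using arg_cong[OF symA', of "\<lambda>M. M $$ (Suc i, Suc j)"] A' n unfolding B_def by simp
  qed (use B in auto)
  \<comment> \<open>The characteristic polynomial is invariant under similarity and multiplicative
    over the blocks, so cancelling the factor of \<open>e\<close> leaves exactly the roots in
    \<open>es\<close>.\<close>
  moreover have "char_poly B = (\<Prod>e\<leftarrow>es. [:- e, 1:])"
  proof -
    have "similar_mat_wit A' A (transpose_mat U) U"
      by (rule similar_mat_witI[of _ _ n]) (use A' A U UU UU' A'_def in auto)
    hence "char_poly A' = char_poly A" by (intro char_poly_similar) (auto simp: similar_mat_def)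
    moreover have "char_poly A' = char_poly E * char_poly B"
      unfolding block by (rule char_poly_four_block_zeros_col[OF E _ B]) simp
    moreover have "char_poly E = [:- e, 1:]"
      by (simp add: E_def char_poly_defs det_def sign_def)
    ultimately have "[:- e, 1:] * char_poly B = [:- e, 1:] * (\<Prod>e\<leftarrow>es. [:- e, 1:])"
      using Cons.prems(3) by (simp del: mult_pCons_left)
    thus ?thesis by (metis mult_cancel_left pCons_eq_0_iff zero_neq_one)
  qed
  ultimately obtain F where F: "F \<in> carrier_mat m m" and FF: "transpose_mat F * F = 1\<^sub>m m"
    and FB: "transpose_mat F * B * F = mat_diag m ((!) es)"
    using Cons.IH[OF B] by blast
  define P where "P = four_block_mat (1\<^sub>m 1) (0\<^sub>m 1 m) (0\<^sub>m m 1) F"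
  have P: "P \<in> carrier_mat n n" unfolding P_def n using F by auto
  have PP: "transpose_mat P * P = 1\<^sub>m n"
    using transpose_congruence_block[OF F one_carrier_mat one_carrier_mat, folded P_def] P F FF n
    by simp
  have "transpose_mat P * A' * P = four_block_mat E (0\<^sub>m 1 m) (0\<^sub>m m 1) (mat_diag m ((!) es))"
    using transpose_congruence_block[OF F B E, folded P_def] unfolding block FB .
  also have "\<dots> = mat_diag n ((!) (e # es))"
    by (intro eq_matI) (auto simp: E_def n mat_diag_def nth_Cons')
  finally have PA: "transpose_mat P * A' * P = mat_diag n ((!) (e # es))" .
  have tUP: "transpose_mat (U * P) = transpose_mat P * transpose_mat U"
    using U P by (rule transpose_mult)
  have "transpose_mat (U * P) * (U * P) = transpose_mat P * (transpose_mat U * U) * P"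
    unfolding tUP using U P by (simp add: assoc_mult_mat[of _ n n _ n _ n])
  moreover have "transpose_mat (U * P) * A * (U * P) = transpose_mat P * A' * P"
    unfolding tUP A'_def using U P A by (simp add: assoc_mult_mat[of _ n n _ n _ n])
  ultimately show ?case using U P UU PP PA by (intro bexI[of _ "U * P"]) auto
qed

section \<open>Upper bounds for the eigenvalues\<close>

text \<open>Only divisibility can be claimed over an arbitrary field, since \<open>p\<close> may
  have a factor without roots. The induction peels off one root with its full order at a
  time.\<close>

lemma prod_proots_dvd:
  fixes p :: "'a :: field poly"
  assumes "p \<noteq> 0"
  shows "(\<Prod>r\<in>#proots p. [:- r, 1:]) dvd p"
  using assms
proof (induction p rule: poly_root_order_induct)
  case (no_roots p)
  hence "proots p = {#}" by (simp add: multiset_eqI order_root)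
  thus ?case by simp
next
  case (root p x k)
  have [simp]: "p \<noteq> 0" using root.hyps by auto
  have "(\<Prod>r\<in>#repeat_mset k {#x#}. [:- r, 1:]) = [:- x, 1:] ^ k" by (induction k) auto
  thus ?case using root.IH by (auto simp: proots_mult proots_power intro: mult_dvd_mono)
qed simp

text \<open>The product divides the characteristic polynomial. Both are monic, and both have degree
  \<open>n\<close> because a symmetric matrix has \<open>n\<close> real eigenvalues, so the quotient
  is 1.\<close>

lemma char_poly_eq_prod_eigenvalues_desc:
  fixes A :: "real mat"
  assumes A: "A \<in> carrier_mat n n" and sym: "transpose_mat A = A"
  shows "char_poly A = (\<Prod>e\<leftarrow>eigenvalues_desc A. [:- e, 1:])"
proof -
  let ?P = "\<Prod>e\<leftarrow>eigenvalues_desc A. [:- e, 1:]"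
  have mset: "mset (eigenvalues_desc A) = proots (char_poly A)"
    unfolding eigenvalues_desc_def by simp
  have monic: "degree (char_poly A) = n" "monic (char_poly A)"
    using degree_monic_char_poly[OF A] by auto
  have P: "?P = (\<Prod>r\<in>#proots (char_poly A). [:- r, 1:])"
    unfolding mset[symmetric] mset_map[symmetric] prod_mset_prod_list ..
  have "degree ?P = n" "monic ?P"
    using degree_linear_factors[of uminus "eigenvalues_desc A"] length_eigenvalues_desc[OF A sym]
by (simp, intro monic_prod_list) auto
  moreover have "char_poly A \<noteq> 0" using monic by auto
  moreover from this obtain q where q: "char_poly A = ?P * q"
    using prod_proots_dvd P by (metis dvdE)
  ultimately have "degree q = 0" using monic by (auto simp: degree_mult_eq)
  moreover have "monic q" using monic \<open>monic ?P\<close> arg_cong[OF q, of lead_coeff, unfolded lead_coeff_mult] by simp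
  ultimately have "q = 1" by (rule monic_degree_0[THEN iffD1, rotated])
  thus ?thesis using q by simp
qed

text \<open>
  The easy half of the Courant-Fischer principle: the span of the eigenvectors of the \<open>k + 1\<close>
  largest eigenvalues meets the subspace of codimension at most \<open>k\<close> given by \<open>S\<close>.
\<close>

lemma eigenvalues_desc_le:
  fixes A :: "real mat"
  assumes A: "A \<in> carrier_mat n n" and sym: "transpose_mat A = A"
    and S: "S \<subseteq> {..<n}" "card S \<le> k" and k: "k < n"
    and form: "\<And>v. v \<in> carrier_vec n \<Longrightarrow> (\<And>i. i \<in> S \<Longrightarrow> v $ i = 0) \<Longrightarrow> v \<bullet> (A *\<^sub>v v) \<le> c * (v \<bullet> v)"
  shows "eigenvalues_desc A ! k \<le> c"
proof -
  define es where "es = eigenvalues_desc A"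
  have len: "length es = n" unfolding es_def by (rule length_eigenvalues_desc[OF A sym])
  have desc: "es ! k \<le> es ! i" if "i \<le> k" for i
  proof -
    have "sorted (rev es)" unfolding es_def eigenvalues_desc_def by simp
    thus ?thesis using that k len by (simp add: sorted_rev_nth_mono)
  qed
  obtain W where W: "W \<in> carrier_mat n n" and WW: "transpose_mat W * W = 1\<^sub>m n"
    and WA: "transpose_mat W * A * W = mat_diag n ((!) es)"
    using symmetric_diagonalisation[OF A sym char_poly_eq_prod_eigenvalues_desc[OF A sym]]
    unfolding es_def by blast
  define ss where "ss = sorted_list_of_set S"
  have finS: "finite S" using S(1) finite_subset by blast
  have ss: "set ss = S" "length ss \<le> k" unfolding ss_def using finS S(2) by auto
  \<comment> \<open>\<open>M\<close> encodes the conditions on the coordinates \<open>y\<close> of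
    the vector sought: the first rows make \<open>W *\<^sub>v y\<close> vanish on \<open>S\<close>,
    the rows after \<open>k\<close> make \<open>y\<close> vanish beyond index \<open>k\<close>.
    Since \<open>length ss\<close> is at most \<open>k\<close>, row \<open>k\<close> is zero; hence
    \<open>M\<close> is singular and a nonzero \<open>y\<close> exists.\<close>
  define M where "M = mat n n (\<lambda>(i, l).
    if i < length ss then W $$ (ss ! i, l) else if k < i \<and> i = l then 1 else 0)"
  have M: "M \<in> carrier_mat n n" unfolding M_def by simp
  have "det M = 0"
    unfolding laplace_expansion_row[OF M k] by (intro sum.neutral) (use ss k in \<open>auto simp: M_def\<close>)
  then obtain y where y: "y \<in> carrier_vec n" "y \<noteq> 0\<^sub>v n" "M *\<^sub>v y = 0\<^sub>v n"
    using det_0_iff_vec_prod_zero[OF M] by blast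
  have y0: "y $ i = 0" if "k < i" "i < n" for i
  proof -
    have "row M i = unit_vec n i" using that ss by (intro eq_vecI) (auto simp: M_def unit_vec_def)
    thus ?thesis using arg_cong[OF y(3), of "\<lambda>v. v $ i"] that M y(1) by simp
  qed
  define v where "v = W *\<^sub>v y"
  have v: "v \<in> carrier_vec n" unfolding v_def using W y by simp
  have v0: "v $ i = 0" if iS: "i \<in> S" for i
  proof -
    obtain j where j: "j < length ss" "ss ! j = i" using iS ss by (metis in_set_conv_nth)
    have i: "i < n" using iS S by auto
    have "row M j = row W i" using j i ss k W by (intro eq_vecI) (auto simp: M_def)
    thus ?thesis using arg_cong[OF y(3), of "\<lambda>v. v $ j"] j i k ss M W unfolding v_def by simp
  qed
  \<comment> \<open>Used twice: the identity matrix gives the squared norm of \<open>v\<close>, and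
    \<open>A\<close> gives the form as a weighted sum of squares.\<close>
  have conj: "v \<bullet> (B *\<^sub>v v) = y \<bullet> ((transpose_mat W * B * W) *\<^sub>v y)"
    if B: "B \<in> carrier_mat n n" for B
  proof -
    have "(transpose_mat W * B * W) *\<^sub>v y = transpose_mat W *\<^sub>v (B *\<^sub>v v)"
      unfolding v_def using W B y
      by (simp add: assoc_mult_mat_vec[of _ n n _ n] assoc_mult_mat[of _ n n _ n _ n])
    also have "y \<bullet> \<dots> = (W *\<^sub>v y) \<bullet> (B *\<^sub>v v)"
      using B v transpose_vec_mult_scalar[of "transpose_mat W" n n "B *\<^sub>v v" y] W y(1) by simp
    finally show ?thesis unfolding v_def ..
  qed
  have vv: "v \<bullet> v = (\<Sum>i<n. (y $ i)\<^sup>2)"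
    using conj[of "1\<^sub>m n"] v W WW y
    by (simp add: scalar_prod_def power2_eq_square lessThan_atLeast0)
  have "v \<bullet> (A *\<^sub>v v) = (\<Sum>i<n. es ! i * (y $ i)\<^sup>2)"
  proof -
    have "(mat_diag n ((!) es) *\<^sub>v y) $ i = es ! i * y $ i" if "i < n" for i
    proof -
      have "row (mat_diag n ((!) es)) i = es ! i \<cdot>\<^sub>v unit_vec n i"
        using that by (intro eq_vecI) (auto simp: mat_diag_def unit_vec_def)
      thus ?thesis using that y by (simp add: mat_diag_def)
    qed
    thus ?thesis
      unfolding conj[OF A] WA
      by (auto simp: scalar_prod_def power2_eq_square lessThan_atLeast0 mat_diag_def mult_ac
          intro!: sum.cong)
  qed
  \<comment> \<open>Up to index \<open>k\<close> the eigenvalues are at least \<open>es ! k\<close>;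
    beyond it the coordinates of \<open>y\<close> vanish.\<close>
  also have "\<dots> \<ge> (\<Sum>i<n. es ! k * (y $ i)\<^sup>2)"
  proof (rule sum_mono)
    fix i assume "i \<in> {..<n}"
    thus "es ! k * (y $ i)\<^sup>2 \<le> es ! i * (y $ i)\<^sup>2"
      using desc[of i] y0[of i] by (cases "i \<le> k") (auto intro: mult_right_mono)
  qed
  finally have "es ! k * (v \<bullet> v) \<le> v \<bullet> (A *\<^sub>v v)" unfolding vv by (simp add: sum_distrib_left)
  also have "\<dots> \<le> c * (v \<bullet> v)" by (rule form[OF v v0])
  finally have le: "es ! k * (v \<bullet> v) \<le> c * (v \<bullet> v)" .
  have "\<exists>i<n. y $ i \<noteq> 0" using y(1,2) by (auto intro!: eq_vecI)
  hence "0 < v \<bullet> v" unfolding vv by (auto intro!: sum_pos2)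
  thus ?thesis using le unfolding es_def by simp
qed

lemma form_le_row_sums:
  fixes A :: "real mat"
  assumes A: "A \<in> carrier_mat n n" and sym: "transpose_mat A = A"
    and nonneg: "\<And>i j. i < n \<Longrightarrow> j < n \<Longrightarrow> 0 \<le> A $$ (i, j)"
    and v: "v \<in> carrier_vec n"
  shows "v \<bullet> (A *\<^sub>v v) \<le> (\<Sum>i<n. (\<Sum>j<n. A $$ (i, j)) * (v $ i)\<^sup>2)"
proof -
  have symA: "A $$ (j, i) = A $$ (i, j)" if "i < n" "j < n" for i j
    using that A arg_cong[OF sym, of "\<lambda>M. M $$ (i, j)"] by simp
  have "v \<bullet> (A *\<^sub>v v) = (\<Sum>i<n. \<Sum>j<n. A $$ (i, j) * (v $ i * v $ j))"
    using A v by (simp add: scalar_prod_def lessThan_atLeast0 sum_distrib_left mult_ac)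
  also have "\<dots> \<le> (\<Sum>i<n. \<Sum>j<n. A $$ (i, j) * (v $ i)\<^sup>2 / 2 + A $$ (i, j) * (v $ j)\<^sup>2 / 2)"
  proof (intro sum_mono)
    fix i j assume "i \<in> {..<n}" "j \<in> {..<n}"
    hence "A $$ (i, j) * (2 * v $ i * v $ j) \<le> A $$ (i, j) * ((v $ i)\<^sup>2 + (v $ j)\<^sup>2)"
      using nonneg by (intro mult_left_mono sum_squares_bound) auto
    thus "A $$ (i, j) * (v $ i * v $ j) \<le> A $$ (i, j) * (v $ i)\<^sup>2 / 2 + A $$ (i, j) * (v $ j)\<^sup>2 / 2"
      by (simp add: distrib_left)
  qed
  also have "\<dots> = (\<Sum>i<n. \<Sum>j<n. A $$ (i, j) * (v $ i)\<^sup>2) / 2 +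
      (\<Sum>i<n. \<Sum>j<n. A $$ (i, j) * (v $ j)\<^sup>2) / 2"
    by (simp only: sum.distrib sum_divide_distrib)
  \<comment> \<open>Symmetry turns the column sums into row sums, so the two halves add up to the
    full bound.\<close>
  also have "(\<Sum>i<n. \<Sum>j<n. A $$ (i, j) * (v $ j)\<^sup>2) = (\<Sum>i<n. \<Sum>j<n. A $$ (i, j) * (v $ i)\<^sup>2)"
    by (subst sum.swap, intro sum.cong refl) (simp add: symA)
  finally show ?thesis by (simp add: sum_distrib_right)
qed

text \<open>Take for \<open>S\<close> the indices of the rows with sum above \<open>c\<close>: on
  vectors vanishing there, every surviving weight in the diagonal form is at most
  \<open>c\<close>.\<close>

lemma eigenvalues_desc_le_row_sums:
  fixes A :: "real mat"
  assumes A: "A \<in> carrier_mat n n" and sym: "transpose_mat A = A"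
    and nonneg: "\<And>i j. i < n \<Longrightarrow> j < n \<Longrightarrow> 0 \<le> A $$ (i, j)"
    and few: "card {i. i < n \<and> c < (\<Sum>j<n. A $$ (i, j))} \<le> k" and k: "k < n"
  shows "eigenvalues_desc A ! k \<le> c"
proof (rule eigenvalues_desc_le[OF A sym _ few k])
  fix v :: "real vec"
  assume v: "v \<in> carrier_vec n" and v0: "\<And>i. i \<in> {i. i < n \<and> c < (\<Sum>j<n. A $$ (i, j))} \<Longrightarrow> v $ i = 0"
  have "v \<bullet> (A *\<^sub>v v) \<le> (\<Sum>i<n. (\<Sum>j<n. A $$ (i, j)) * (v $ i)\<^sup>2)"
    by (rule form_le_row_sums[OF A sym nonneg v])
  also have "\<dots> \<le> (\<Sum>i<n. c * (v $ i)\<^sup>2)"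
  proof (rule sum_mono)
    fix i assume "i \<in> {..<n}"
    thus "(\<Sum>j<n. A $$ (i, j)) * (v $ i)\<^sup>2 \<le> c * (v $ i)\<^sup>2"
      using v0[of i] by (cases "c < (\<Sum>j<n. A $$ (i, j))") (auto intro: mult_right_mono)
  qed
  also have "\<dots> = c * (v \<bullet> v)"
    using v by (simp add: scalar_prod_def power2_eq_square lessThan_atLeast0 sum_distrib_left)
  finally show "v \<bullet> (A *\<^sub>v v) \<le> c * (v \<bullet> v)" .
qed auto

section \<open>The connection matrix\<close>

text \<open>This is the expansion of the product of \<open>1 - 1\<close> over
  \<open>A\<close>.\<close>

lemma sum_minus_one_power_card:
  assumes "finite A" "A \<noteq> {}"
  shows "(\<Sum>X\<in>Pow A. (-1 :: int) ^ card X) = 0"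
  using prod_diff_conv_sum[OF assms(1), of "\<lambda>_. 1 :: int" "\<lambda>_. 1"] assms by (simp add: power_0_left)

text \<open>Since the dimension is one less than the cardinality, every sign flips. The alternating
  sum over all subsets is 0, and removing the empty set, which contributes 1, leaves 1 after the
  flip.\<close>

lemma euler_char_simplex:
  assumes "finite A" "A \<noteq> {}"
  shows "euler_char (Pow A - {{}}) = 1"
proof -
  have "euler_char (Pow A - {{}}) = (\<Sum>X\<in>Pow A - {{}}. - ((-1) ^ card X))"
    unfolding euler_char_def
  proof (intro sum.cong refl)
    fix X assume "X \<in> Pow A - {{}}"
    hence "0 < card X" using assms(1) finite_subset by (auto simp: card_gt_0_iff)
    thus "simplex_sign X = - ((-1) ^ card X)"
      unfolding simplex_sign_def simplex_dim_def by (cases "card X") auto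
  qed
  also have "\<dots> = 1"
    using sum_minus_one_power_card[OF assms] assms(1)
    by (simp add: sum_negf sum_diff1)
  finally show ?thesis .
qed

text \<open>Closure under non-empty subsets makes the two cores meet in the full simplex on the
  common vertices, or in nothing.\<close>

lemma euler_char_core_inter:
  assumes G: "simplicial_complex G" and "x \<in> G" "y \<in> G"
  shows "euler_char (core G x \<inter> core G y) = (if x \<inter> y = {} then 0 else 1)"
proof -
  have core: "core G x \<inter> core G y = Pow (x \<inter> y) - {{}}"
    using assms unfolding simplicial_complex_def core_def by blast
  show ?thesis
  proof (cases "x \<inter> y = {}")
    case False
    have "finite (x \<inter> y)" using assms unfolding simplicial_complex_def by blast
    thus ?thesis unfolding core using False euler_char_simplex by (simp only: if_False)
  qed (simp add: core euler_char_def)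
qed

lemma row_sum_connection_matrix:
  assumes G: "simplicial_complex G" and xs: "distinct xs" "set xs = G" and i: "i < length xs"
  shows "(\<Sum>j<length xs. connection_matrix G xs $$ (i, j)) = real (connection_degree G (xs ! i))"
proof -
  have xi: "xs ! i \<in> G" using i xs(2) by auto
  let ?e = "\<lambda>y. euler_char (core G (xs ! i) \<inter> core G y)"
  have "(\<Sum>j<length xs. connection_matrix G xs $$ (i, j)) = (\<Sum>j<length xs. real_of_int (?e (xs ! j)))"
    using i by (intro sum.cong) (auto simp: connection_matrix_def)
  also have "\<dots> = (\<Sum>y\<in>G. real_of_int (?e y))"
    using xs by (intro sum.reindex_bij_betw bij_betw_nth) auto
  \<comment> \<open>Each entry is 0 or 1, so summing the row counts its nonzero entries.\<close>
  also have "\<dots> = (\<Sum>y\<in>G. if ?e y \<noteq> 0 then 1 else 0)"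
    using euler_char_core_inter[OF G xi] by (intro sum.cong) auto
  also have "\<dots> = real (connection_degree G (xs ! i))"
    using xs(2) unfolding connection_degree_def
    by (subst sum.If_cases) (auto simp: Int_def intro!: arg_cong[of _ _ card])
  finally show ?thesis .
qed

text \<open>In a descending list a strictly larger entry must stand before position
  \<open>k\<close>. The comparison is strict, so ties with \<open>ys ! k\<close> do no harm.\<close>

lemma card_greater_nth_desc:
  fixes ys :: "'a :: linorder list"
  assumes "sorted (rev ys)" and k: "k < length ys"
  shows "size (filter_mset (\<lambda>y. ys ! k < y) (mset ys)) \<le> k"
proof -
  have "{i. i < length ys \<and> ys ! k < ys ! i} \<subseteq> {..<k}"
  proof (rule subsetI)
    fix i assume i: "i \<in> {i. i < length ys \<and> ys ! k < ys ! i}"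
    show "i \<in> {..<k}"
    proof (rule ccontr)
      assume "i \<notin> {..<k}"
      hence "ys ! i \<le> ys ! k" using i by (intro sorted_rev_nth_mono[OF assms(1)]) auto
      thus False using i by (auto dest: leD)
    qed
  qed
  hence "card {i. i < length ys \<and> ys ! k < ys ! i} \<le> k"
    using card_mono[OF finite_lessThan] by fastforce
  thus ?thesis by (simp flip: mset_filter add: length_filter_conv_card)
qed

theorem theorem1:
  fixes G :: "'a set set" and xs :: "'a set list" and j :: nat
  assumes "simplicial_complex G"
    and "distinct xs" and "set xs = G"
    and "1 \<le> j" and "j \<le> card G"
  shows "eigenvalues_desc (connection_matrix G xs) ! (j - 1) \<le> real (degrees_desc G ! (j - 1))"
proof -
  let ?L = "connection_matrix G xs" and ?n = "length xs" and ?d = "degrees_desc G ! (j - 1)"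
  have n: "?n = card G" using distinct_card[OF assms(2)] assms(3) by simp
  \<comment> \<open>The sorted degrees and the degrees along \<open>xs\<close> agree as multisets.
    Only the number of degrees above a threshold matters, so no permutation has to be
    chosen.\<close>
  have mset_d: "mset (degrees_desc G) = mset (map (connection_degree G) xs)"
    unfolding degrees_desc_def assms(3)[symmetric] mset_set_set[OF assms(2)] by simp
  hence len_d: "length (degrees_desc G) = ?n" by (metis length_map size_mset)
  have "size (filter_mset (\<lambda>y. ?d < y) (mset (degrees_desc G))) \<le> j - 1"
    using assms(4,5) len_d n by (intro card_greater_nth_desc) (auto simp: degrees_desc_def)
  hence "card {i. i < ?n \<and> ?d < connection_degree G (xs ! i)} \<le> j - 1"
    unfolding mset_d by (simp flip: mset_filter mset_map add: length_filter_conv_card cong: conj_cong)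
  moreover have "{i. i < ?n \<and> real ?d < (\<Sum>l<?n. ?L $$ (i, l))} =
      {i. i < ?n \<and> ?d < connection_degree G (xs ! i)}"
    using row_sum_connection_matrix[OF assms(1-3)] by auto
  ultimately have few: "card {i. i < ?n \<and> real ?d < (\<Sum>l<?n. ?L $$ (i, l))} \<le> j - 1" by simp
  show ?thesis
  proof (rule eigenvalues_desc_le_row_sums[OF _ _ _ few])
    show "?L \<in> carrier_mat ?n ?n" "transpose_mat ?L = ?L"
      by (auto simp: connection_matrix_def Int_commute)
    show "0 \<le> ?L $$ (i, l)" if "i < ?n" "l < ?n" for i l
      using that assms(3) euler_char_core_inter[OF assms(1), of "xs ! i" "xs ! l"]
      by (auto simp: connection_matrix_def)
    show "j - 1 < ?n" using assms(4,5) n by simp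
  qed
qed

end
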